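(* For every positive integer $r$, the graph of an $\{r,r+1\}$-leaper on a $(4r+2)\times(4r+2)$ board is Hamiltonian (has a cycle through every vertex exactly once).
   Context: For positive integers $r,s$, the graph of an $\{r,s\}$-leaper on an $m\times n$ board has vertex set $\{(x,y): 0\le x<m,\ 0\le y<n\}$ (integers), with an edge between $(x,y)$ and $(x',y')$ whenever $(x'-x,y'-y)\in\{(\pm r,\pm s),(\pm s,\pm r)\}$. *)

theory Defs
  imports "Graph_Theory.Pair_Digraph"
begin

(* Undirected graphs are symmetric digraphs, as usual in Graph_Theory; see the lemma
   pair_graph_leaper_graph below. *)
definition leaper_graph :: "nat \<Rightarrow> nat \<Rightarrow> nat \<Rightarrow> nat \<Rightarrow> (int \<times> int) pair_pre_digraph" where
  "leaper_graph r s m n =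
    (let V = {(x, y). 0 \<le> x \<and> x < int m \<and> 0 \<le> y \<and> y < int n}
     in \<lparr> pverts = V,
          parcs = {((x, y), (x', y')). (x, y) \<in> V \<and> (x', y') \<in> V \<and>
            (x' - x, y' - y) \<in> {int r, - int r} \<times> {int s, - int s} \<union> {int s, - int s} \<times> {int r, - int r}} \<rparr>)"

lemma pair_graph_leaper_graph:
  assumes "0 < r" "0 < s"
  shows "pair_graph (leaper_graph r s m n)"
proof -
  let ?G = "leaper_graph r s m n"
  have verts: "pverts ?G = {0..<int m} \<times> {0..<int n}"
    unfolding leaper_graph_def Let_def by auto
  have sub: "parcs ?G \<subseteq> pverts ?G \<times> pverts ?G"
    unfolding leaper_graph_def Let_def by auto
  have fin: "finite (pverts ?G)"
    unfolding verts by simp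
  have fin': "finite (parcs ?G)"
    by (rule finite_subset[OF sub finite_cartesian_product[OF fin fin]])
  have neg: "(x' - x, y' - y) \<in> A \<times> B \<union> B \<times> A \<Longrightarrow> (x - x', y - y') \<in> A \<times> B \<union> B \<times> A"
    if "uminus ` A \<subseteq> A" "uminus ` B \<subseteq> B" for A B :: "int set" and x x' y y'
  proof -
    assume "(x' - x, y' - y) \<in> A \<times> B \<union> B \<times> A"
    then have "(- (x' - x), - (y' - y)) \<in> A \<times> B \<union> B \<times> A"
      using that by blast
    then show ?thesis by simp
  qed
  have sym: "sym (parcs ?G)"
  proof (rule symI)
    fix u v assume "(u, v) \<in> parcs ?G"
    then show "(v, u) \<in> parcs ?G"
      using neg[of "{int r, - int r}" "{int s, - int s}" "fst v" "fst u" "snd v" "snd u"]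
      unfolding leaper_graph_def Let_def by (cases u; cases v) simp
  qed
  have "fst e \<noteq> snd e" if "e \<in> parcs ?G" for e
  proof
    assume "fst e = snd e"
    with that have "(0, 0) \<in> {int r, - int r} \<times> {int s, - int s} \<union> {int s, - int s} \<times> {int r, - int r}"
      unfolding leaper_graph_def Let_def by (cases e) (clarsimp simp del: Un_iff)
    with assms show False by simp
  qed
  then show ?thesis
    using fin fin' sub sym
    by unfold_locales (simp_all add: subset_iff symmetric_def split_paired_all)
qed

(* The constant cycle also admits u, v, u, which in a
   symmetric digraph traverses a single undirected edge twice; hence the bound 3. In a cycle
   the heads of the arcs are distinct, so the tails are distinct as well and every vertex
   is visited exactly once. *)
definition (in pre_digraph) hamiltonian :: bool where
  "hamiltonian \<longleftrightarrow> (\<exists>p. cycle p \<and> 3 \<le> length p \<and> tail G ` set p = verts G)"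

end

(* Two leaper moves whose sum is a unit diagonal vector, applied alternately, sweep two parallel
   diagonal segments of the board. At the cells near the corners all moves but two leave the board,
   so almost the whole tour is forced to consist of such zigzags, and only the way they are joined
   near the lines x, y = r, 2r + 1, 3r + 2 is free. The tour used here is invariant under the half
   turn s of the board. Let A k = (r, r + k) and B k = (3r + 1, r + k). A few zigzags lead
   from A k to s (A (k + 2)), and others from B k to s (B (k - 2)), so that k grows along the spirals
   through the A's and shrinks along those through the B's. The spirals are joined by
   A (r - 2) -> s (B (r - 2)), A (r - 1) -> B (r - 1), B 0 -> s (A 1) and B 1 -> s (A 0).
   Modulo s this is the closed walk A 0, ..., B 0, A 1, ..., B 1, A 0 with half as many steps as
   there are cells, and it has an odd number of half turns, so that it lifts to a tour.
   For r = 1 there is no A 1, and half a tour is given explicitly. *)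
theory Submission
  imports Defs
begin

section \<open>Leaper moves on the board and walks along them\<close>

definition board :: "int \<Rightarrow> (int \<times> int) set" where
  "board r = {0..4 * r + 1} \<times> {0..4 * r + 1}"

definition move :: "int \<Rightarrow> int \<Rightarrow> int \<Rightarrow> bool" where
  "move r a b \<longleftrightarrow> \<bar>a\<bar> = r \<and> \<bar>b\<bar> = r + 1 \<or> \<bar>a\<bar> = r + 1 \<and> \<bar>b\<bar> = r"

definition adj :: "int \<Rightarrow> int \<times> int \<Rightarrow> int \<times> int \<Rightarrow> bool" where
  "adj r u v \<longleftrightarrow> u \<in> board r \<and> v \<in> board r \<and> move r (fst v - fst u) (snd v - snd u)"

abbreviation half_turn :: "int \<Rightarrow> int \<times> int \<Rightarrow> int \<times> int" where
  "half_turn r v \<equiv> (4 * r + 1 - fst v, 4 * r + 1 - snd v)"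

text \<open>\<open>S\<close> only has to be covered by the \<open>n\<close> vertices before \<open>v\<close>. Injectivity is never tracked: a closed
  walk that covers the board and has as many steps as the board has cells cannot repeat a vertex.\<close>

definition walk :: "int \<Rightarrow> int \<times> int \<Rightarrow> int \<times> int \<Rightarrow> int \<Rightarrow> (int \<times> int) set \<Rightarrow> bool" where
  "walk r u v n S \<longleftrightarrow> (\<exists>vs. successively (adj r) (vs @ [v]) \<and> hd (vs @ [v]) = u
     \<and> int (length vs) = n \<and> S \<subseteq> set vs)"

lemma walk_list:
  "successively (adj r) (vs @ [v]) \<Longrightarrow> walk r (hd (vs @ [v])) v (int (length vs)) (set vs)"
  unfolding walk_def by blast

lemma walk_weaken:
  assumes "walk r u v n S" "n = n'" "T \<subseteq> S"
  shows "walk r u v n' T"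
  using assms unfolding walk_def by blast

lemma walk_step: "adj r u v \<Longrightarrow> walk r u v 1 {u}"
  using walk_list[of r "[u]" v] by simp

text \<open>The end vertex of a walk is not among its counted vertices, so the junction
  \<open>v\<close> is counted once and the lengths simply add.\<close>

lemma walk_trans:
  assumes "walk r u v n S" "walk r v w m T"
  shows "walk r u w (n + m) (S \<union> T)"
proof -
  obtain us where us: "successively (adj r) (us @ [v])" "hd (us @ [v]) = u" "int (length us) = n" "S \<subseteq> set us"
    using assms(1) unfolding walk_def by blast
  obtain vs where vs: "successively (adj r) (vs @ [w])" "hd (vs @ [w]) = v" "int (length vs) = m" "T \<subseteq> set vs"
    using assms(2) unfolding walk_def by blast
  have "successively (adj r) (us @ vs @ [w])"
    using us(1,2) vs(1,2) by (auto simp: successively_append_iff)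
  moreover have "hd (us @ vs @ [w]) = u"
    using us(2) vs(2) by (cases us) auto
  ultimately show ?thesis
    unfolding walk_def using us vs by (intro exI[of _ "us @ vs"]) auto
qed

lemma adj_half_turn: "adj r u v \<Longrightarrow> adj r (half_turn r u) (half_turn r v)"
  by (simp add: adj_def board_def move_def mem_Times_iff abs_minus_commute)

lemma walk_half_turn:
  assumes "walk r u v n S"
  shows "walk r (half_turn r u) (half_turn r v) n (half_turn r ` S)"
proof -
  obtain vs where vs: "successively (adj r) (vs @ [v])" "hd (vs @ [v]) = u" "int (length vs) = n" "S \<subseteq> set vs"
    using assms unfolding walk_def by blast
  have "successively (adj r) (map (half_turn r) (vs @ [v]))"
    unfolding successively_map by (rule successively_mono[OF vs(1)]) (rule adj_half_turn)
  moreover have "hd (map (half_turn r) (vs @ [v])) = half_turn r u"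
    by (subst hd_map) (simp_all add: vs(2))
  ultimately show ?thesis
    unfolding walk_def using vs(3,4) by (intro exI[of _ "map (half_turn r) vs"]) auto
qed

section \<open>Zigzags along parallel diagonals\<close>

text \<open>The moves \<open>(a, b)\<close> and \<open>(s - a, t - b)\<close> add up to the diagonal
  unit vector \<open>(s, t)\<close>, so \<open>m\<close> pairs of them advance by \<open>m\<close>
  along the diagonal and visit \<open>m\<close> cells of each of two parallel diagonals. As
  \<open>s\<close> and \<open>t\<close> are signs, \<open>s * (x' - x)\<close> recovers the position
  on the diagonal; this describes the cells without an existential and keeps later inclusions within
  linear arithmetic. The first diagonal must stay on the board up to \<open>i = m\<close>, since the
  walk ends there.\<close>

lemma zigzag_even_aux:
  assumes "m \<ge> 0" and "s \<in> {1, -1}" and "t \<in> {1, -1}"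
    and "move r a b" and "move r (s - a) (t - b)"
    and "\<And>i. 0 \<le> i \<Longrightarrow> i \<le> m \<Longrightarrow> (x + i * s, y + i * t) \<in> board r"
    and "\<And>i. 0 \<le> i \<Longrightarrow> i < m \<Longrightarrow> (x + a + i * s, y + b + i * t) \<in> board r"
  shows "walk r (x, y) (x + m * s, y + m * t) (2 * m)
    ({(x', y'). s * (x' - x) = t * (y' - y) \<and> 0 \<le> s * (x' - x) \<and> s * (x' - x) < m} \<union>
     {(x', y'). s * (x' - x - a) = t * (y' - y - b) \<and> 0 \<le> s * (x' - x - a) \<and> s * (x' - x - a) < m})"
  using assms(1,6,7)
proof (induction m rule: int_ge_induct)
  case base
  have "walk r (x, y) (x, y) 0 {}"
    using walk_list[of r "[]"] by simp
  then have "walk r (x, y) (x + 0 * s, y + 0 * t) (2 * 0) {}"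
    by simp
  then show ?case by (rule walk_weaken) auto
next
  case (step i)
  have ih: "walk r (x, y) (x + i * s, y + i * t) (2 * i)
    ({(x', y'). s * (x' - x) = t * (y' - y) \<and> 0 \<le> s * (x' - x) \<and> s * (x' - x) < i} \<union>
     {(x', y'). s * (x' - x - a) = t * (y' - y - b) \<and> 0 \<le> s * (x' - x - a) \<and> s * (x' - x - a) < i})"
    using step by auto
  have 1: "walk r (x + i * s, y + i * t) (x + a + i * s, y + b + i * t) 1 {(x + i * s, y + i * t)}"
    using step assms(4) by (intro walk_step) (simp add: adj_def)
  have 2: "walk r (x + a + i * s, y + b + i * t) (x + (i + 1) * s, y + (i + 1) * t) 1 {(x + a + i * s, y + b + i * t)}"
    using step.prems(1)[of "i + 1"] step.prems(2)[of i] step.hyps assms(5)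
    by (intro walk_step) (simp add: adj_def algebra_simps)
  show ?case
    by (rule walk_weaken[OF walk_trans[OF ih walk_trans[OF 1 2]]]) (use assms(2,3) step.hyps in auto)
qed

text \<open>One more move \<open>(a, b)\<close> follows the \<open>m\<close> pairs. The cell with
  index \<open>m\<close> on the first diagonal is now counted, whereas that on the second is the end
  vertex and is not.\<close>

lemma zigzag_odd_aux:
  assumes "m \<ge> 0" and "s \<in> {1, -1}" and "t \<in> {1, -1}"
    and "move r a b" and "move r (s - a) (t - b)"
    and "\<And>i. 0 \<le> i \<Longrightarrow> i \<le> m \<Longrightarrow> (x + i * s, y + i * t) \<in> board r"
    and "\<And>i. 0 \<le> i \<Longrightarrow> i \<le> m \<Longrightarrow> (x + a + i * s, y + b + i * t) \<in> board r"
  shows "walk r (x, y) (x + a + m * s, y + b + m * t) (2 * m + 1)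
    ({(x', y'). s * (x' - x) = t * (y' - y) \<and> 0 \<le> s * (x' - x) \<and> s * (x' - x) \<le> m} \<union>
     {(x', y'). s * (x' - x - a) = t * (y' - y - b) \<and> 0 \<le> s * (x' - x - a) \<and> s * (x' - x - a) < m})"
proof -
  have "walk r (x + m * s, y + m * t) (x + a + m * s, y + b + m * t) 1 {(x + m * s, y + m * t)}"
    using assms by (intro walk_step) (simp add: adj_def)
  from walk_trans[OF zigzag_even_aux[OF assms(1-6)] this]
  show ?thesis
    by (rule walk_weaken) (use assms in auto)
qed

text \<open>Endpoint, length and cell set become variables tied by side conditions, so that the rule
  unifies with goals written in any normal form.\<close>

lemma zigzag_even:
  assumes "m \<ge> 0" and "s \<in> {1, -1}" and "t \<in> {1, -1}"
    and "move r a b" and "move r (s - a) (t - b)"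
    and "\<And>i. 0 \<le> i \<Longrightarrow> i \<le> m \<Longrightarrow> (x + i * s, y + i * t) \<in> board r"
    and "\<And>i. 0 \<le> i \<Longrightarrow> i < m \<Longrightarrow> (x + a + i * s, y + b + i * t) \<in> board r"
    and "x' = x + m * s" "y' = y + m * t" "n = 2 * m"
    and "S \<subseteq> {(x', y'). s * (x' - x) = t * (y' - y) \<and> 0 \<le> s * (x' - x) \<and> s * (x' - x) < m} \<union>
     {(x', y'). s * (x' - x - a) = t * (y' - y - b) \<and> 0 \<le> s * (x' - x - a) \<and> s * (x' - x - a) < m}"
  shows "walk r (x, y) (x', y') n S"
  using walk_weaken[OF zigzag_even_aux[OF assms(1-7)] _ assms(11)] assms(8-10) by simp

lemma zigzag_odd:
  assumes "m \<ge> 0" and "s \<in> {1, -1}" and "t \<in> {1, -1}"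
    and "move r a b" and "move r (s - a) (t - b)"
    and "\<And>i. 0 \<le> i \<Longrightarrow> i \<le> m \<Longrightarrow> (x + i * s, y + i * t) \<in> board r"
    and "\<And>i. 0 \<le> i \<Longrightarrow> i \<le> m \<Longrightarrow> (x + a + i * s, y + b + i * t) \<in> board r"
    and "x' = x + a + m * s" "y' = y + b + m * t" "n = 2 * m + 1"
    and "S \<subseteq> {(x', y'). s * (x' - x) = t * (y' - y) \<and> 0 \<le> s * (x' - x) \<and> s * (x' - x) \<le> m} \<union>
     {(x', y'). s * (x' - x - a) = t * (y' - y - b) \<and> 0 \<le> s * (x' - x - a) \<and> s * (x' - x - a) < m}"
  shows "walk r (x, y) (x', y') n S"
  using walk_weaken[OF zigzag_odd_aux[OF assms(1-7)] _ assms(11)] assms(8-10) by simp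

section \<open>From closed walks to Hamiltonian cycles\<close>

lemma hamiltonian_pair_digraphI:
  fixes G :: "'a pair_pre_digraph"
  assumes "successively (\<lambda>u v. (u, v) \<in> parcs G) (vs @ [u])" and "hd (vs @ [u]) = u"
    and "distinct vs" and "set vs = pverts G" and "3 \<le> length vs"
  shows "pre_digraph.hamiltonian (with_proj G)"
proof -
  interpret pre_digraph "with_proj G" .
  \<comment> \<open>The arcs join consecutive vertices: their tails form \<open>vs\<close>, and
    their heads form the rotation of \<open>vs\<close> by one place.\<close>
  let ?p = "zip vs (tl (vs @ [u]))"
  \<comment> \<open>Start and end are decoupled for the induction: it removes vertices at the front,
    so only the end stays fixed.\<close>
  have "cas (hd (us @ [v])) (zip us (tl (us @ [v]))) v \<and> set (zip us (tl (us @ [v]))) \<subseteq> parcs G"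
    if "successively (\<lambda>u v. (u, v) \<in> parcs G) (us @ [v])" for us v
    using that
  proof (induction us)
    case (Cons w us)
    then show ?case by (cases us) auto
  qed simp
  from this[OF assms(1)] have p: "cas u ?p u" "set ?p \<subseteq> parcs G"
    using assms(2) by simp_all
  have len: "length (tl (vs @ [u])) = length vs" by simp
  obtain vs' where vs': "vs = u # vs'"
    using assms(2,5) by (cases vs) auto
  then have "awalk u ?p u"
    using p assms(4) unfolding awalk_def by auto
  moreover have "tl (awalk_verts u ?p) = map snd ?p"
    using p(1) by (simp add: awalk_verts_conv')
  then have "tl (awalk_verts u ?p) = tl (vs @ [u])"
    using len by (simp add: map_snd_zip)
  then have "distinct (tl (awalk_verts u ?p))"
    using assms(3) vs' by auto
  moreover have "?p \<noteq> []"
    using vs' by simp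
  moreover have "fst ` set ?p = set vs"
    by (metis len list.set_map map_fst_zip)
  ultimately show ?thesis
    unfolding hamiltonian_def cycle_def using assms(4,5) len
    by (intro exI[of _ ?p] conjI exI[of _ u]) simp_all
qed

lemma hamiltonian_of_closed_walk:
  fixes r :: nat
  assumes w: "walk (int r) u u ((4 * int r + 2)^2) (board (int r))"
  shows "pre_digraph.hamiltonian (with_proj (leaper_graph r (r + 1) (4 * r + 2) (4 * r + 2)))"
proof -
  let ?G = "leaper_graph r (r + 1) (4 * r + 2) (4 * r + 2)"
  have arc: "(u, v) \<in> parcs ?G" if "adj (int r) u v" for u v
  proof -
    have "(a, b) \<in> {int r, - int r} \<times> {int (r + 1), - int (r + 1)} \<union>
        {int (r + 1), - int (r + 1)} \<times> {int r, - int r}" if "move (int r) a b" for a b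
      using that by (cases "0 \<le> a"; cases "0 \<le> b") (auto simp: move_def)
    then have "(fst v - fst u, snd v - snd u) \<in> {int r, - int r} \<times> {int (r + 1), - int (r + 1)} \<union>
        {int (r + 1), - int (r + 1)} \<times> {int r, - int r}"
      using that unfolding adj_def by blast
    moreover have "u \<in> board (int r)" "v \<in> board (int r)"
      using that by (simp_all add: adj_def)
    ultimately show ?thesis
      by (simp add: leaper_graph_def board_def case_prod_beta mem_Times_iff)
  qed
  have verts: "pverts ?G = board (int r)"
    by (auto simp: leaper_graph_def board_def)
  obtain vs where vs: "successively (adj (int r)) (vs @ [u])" "hd (vs @ [u]) = u"
     "int (length vs) = (4 * int r + 2)^2" "board (int r) \<subseteq> set vs"
    using w unfolding walk_def by blast
  \<comment> \<open>Each vertex in \<open>vs\<close> has a successor in \<open>vs @ [u]\<close>, and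
    \<open>adj\<close> places both ends of a move on the board. Hence \<open>vs\<close> lists
    exactly the cells, and comparing its length with their number shows that it is distinct.\<close>
  have in_board: "set vs \<subseteq> board (int r)"
  proof
    fix v assume "v \<in> set vs"
    then obtain xs ys where "vs = xs @ v # ys" by (meson split_list)
    then show "v \<in> board (int r)"
      using vs(1) by (cases ys) (auto simp: successively_append_iff adj_def)
  qed
  have "card (board (int r)) = (4 * r + 2) * (4 * r + 2)"
    unfolding board_def card_cartesian_product by (simp add: nat_add_distrib nat_mult_distrib)
  moreover from this have "int (card (board (int r))) = (4 * int r + 2)^2"
    by (simp add: power2_eq_square algebra_simps)
  then have "length vs = card (board (int r))"
    using vs(3) by linarith
  ultimately have "distinct vs" "3 \<le> length vs"
    using in_board vs(4) by (metis card_distinct subset_antisym, simp)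
  then show ?thesis
    using vs(2) in_board vs(4) verts
    by (intro hamiltonian_pair_digraphI[of ?G vs u] successively_mono[OF vs(1) arc]) auto
qed

section \<open>Walks modulo the half turn\<close>

text \<open>A walk in the quotient of the board by the half turn; \<open>b\<close> records on which of the two sheets
  its lift ends.\<close>

definition twisted_walk :: "int \<Rightarrow> bool \<Rightarrow> int \<times> int \<Rightarrow> int \<times> int \<Rightarrow> int \<Rightarrow> (int \<times> int) set \<Rightarrow> bool" where
  "twisted_walk r b u v n S \<longleftrightarrow>
     (\<exists>T. walk r u (if b then half_turn r v else v) n T \<and> S \<subseteq> T \<union> half_turn r ` T)"

lemma twisted_walkI:
  "walk r u v n S \<Longrightarrow> twisted_walk r False u v n S"
  "walk r u (half_turn r v) n S \<Longrightarrow> twisted_walk r True u v n S"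
  unfolding twisted_walk_def by auto

lemma twisted_walk_weaken:
  assumes "twisted_walk r b u v n S" "n = n'" "S' \<subseteq> S"
  shows "twisted_walk r b u v n' S'"
  using assms unfolding twisted_walk_def by blast

text \<open>Sheets add modulo 2, which is why the flag of the composite is the exclusive or
  \<open>b \<noteq> c\<close>.\<close>

lemma twisted_walk_trans:
  assumes "twisted_walk r b u v n S" "twisted_walk r c v w m S'"
  shows "twisted_walk r (b \<noteq> c) u w (n + m) (S \<union> S')"
proof -
  obtain T where T: "walk r u (if b then half_turn r v else v) n T" "S \<subseteq> T \<union> half_turn r ` T"
    using assms(1) unfolding twisted_walk_def by blast
  obtain T' where T': "walk r v (if c then half_turn r w else w) m T'" "S' \<subseteq> T' \<union> half_turn r ` T'"
    using assms(2) unfolding twisted_walk_def by blast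
  \<comment> \<open>The second walk has to start on the sheet where the first one ended, so its lift
    is rotated if \<open>b\<close> holds. Coverage modulo the half turn does not change.\<close>
  define T'' where "T'' = (if b then half_turn r ` T' else T')"
  have "walk r (if b then half_turn r v else v) (if b \<noteq> c then half_turn r w else w) m T''"
    using T'(1) walk_half_turn[OF T'(1)] by (cases b; cases c) (simp_all add: T''_def)
  then have "walk r u (if b \<noteq> c then half_turn r w else w) (n + m) (T \<union> T'')"
    by (rule walk_trans[OF T(1)])
  moreover have "T'' \<union> half_turn r ` T'' = T' \<union> half_turn r ` T'"
    by (auto simp: T''_def image_image)
  then have "S \<union> S' \<subseteq> (T \<union> T'') \<union> half_turn r ` (T \<union> T'')"
    using T(2) T'(2) by (auto simp: image_Un)
  ultimately show ?thesis
    unfolding twisted_walk_def by blast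
qed

text \<open>A lift that ends at the half turn of its start is continued by its own rotated copy,
  which leads back to \<open>u\<close>.\<close>

lemma closed_walk_of_twisted_walk:
  assumes tw: "twisted_walk r True u u n S" and cover: "board r \<subseteq> S \<union> half_turn r ` S"
  shows "walk r u u (2 * n) (board r)"
proof -
  obtain T where T: "walk r u (half_turn r u) n T" "S \<subseteq> T \<union> half_turn r ` T"
    using tw unfolding twisted_walk_def by auto
  have "walk r u u (n + n) (T \<union> half_turn r ` T)"
    using walk_trans[OF T(1) walk_half_turn[OF T(1)]] by simp
  moreover have "half_turn r ` S \<subseteq> T \<union> half_turn r ` T"
    using image_mono[OF T(2), of "half_turn r"] by (simp add: image_Un image_image Un_commute)
  then have "board r \<subseteq> T \<union> half_turn r ` T"
    using cover T(2) by (meson Un_least order_trans)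
  ultimately show ?thesis
    by (elim walk_weaken) simp_all
qed

section \<open>The pieces of the spirals and their cells\<close>

text \<open>The cells that \<open>A_step\<close>, \<open>A_second_last\<close>, \<open>A_last\<close> walk through from \<open>(r, r + k)\<close>, and
  those that \<open>B_step\<close>, \<open>B_one\<close>, \<open>B_zero\<close> walk through from \<open>(3r + 1, r + k)\<close>, grouped by zigzag.\<close>

definition A_cells :: "int \<Rightarrow> int \<Rightarrow> (int \<times> int) set" where
  "A_cells r k =
    (if k \<le> r - 3 then
     {(x, y). x = r \<and> y = r + k \<or> 2 * r + 1 \<le> x \<and> 0 \<le> y \<and> x + y = 2 * r + 1 + k \<or>
       3 * r + 2 \<le> x \<and> r \<le> y \<and> x + y = 4 * r + 2 + k} \<union>
     ({(x, y). 2 * r + 1 \<le> x \<and> 2 * r + 1 \<le> y \<and> x + y = 4 * r + 3 + k \<or>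
       3 * r + 2 \<le> x \<and> 3 * r + 2 \<le> y \<and> x + y = 6 * r + 4 + k} \<union>
     ({(x, y). x - y = - 2 - k \<and> 3 * r - k \<le> x \<and> x \<le> 3 * r + 1 \<or>
       x - y = 2 * r - 1 - k \<and> 4 * r - k \<le> x \<and> x \<le> 4 * r + 1} \<union>
     ({(x, y). x + y = 6 * r - k \<and> 3 * r - 1 - k \<le> x \<and> x \<le> 3 * r \<or>
       x + y = 8 * r + 1 - k \<and> 4 * r - k \<le> x \<and> x \<le> 4 * r + 1})))
    else if k = r - 2 then
     {(x, y). x = r \<and> y = r + k \<or> 2 * r + 1 \<le> x \<and> 0 \<le> y \<and> x + y = 2 * r + 1 + k \<or>
       3 * r + 2 \<le> x \<and> r \<le> y \<and> x + y = 4 * r + 2 + k} \<union>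
     ({(x, y). 2 * r + 1 \<le> x \<and> 2 * r + 1 \<le> y \<and> x + y = 4 * r + 3 + k \<or>
       3 * r + 2 \<le> x \<and> 3 * r + 2 \<le> y \<and> x + y = 6 * r + 4 + k} \<union>
     ({(x, y). x - y = - 2 - k \<and> 3 * r - k \<le> x \<and> x \<le> 3 * r + 1 \<or>
       x - y = 2 * r - 1 - k \<and> 4 * r - k + 1 \<le> x \<and> x \<le> 4 * r + 1} \<union>
     ({(3 * r + 2, 2 * r + 1)} \<union>
     ({(x, y). x - y = r \<and> 2 * r + 1 \<le> x \<and> x \<le> 3 * r - 1 \<or>
       x - y = 3 * r + 1 \<and> 3 * r + 2 \<le> x \<and> x \<le> 4 * r} \<union>
     ({(3 * r, 2 * r)} \<union>
     ({(x, y). x - y = r - 1 \<and> 3 * r + 2 \<le> x \<and> x \<le> 4 * r \<or>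
       x - y = - r - 2 \<and> 2 * r + 2 \<le> x \<and> x \<le> 3 * r - 1} \<union>
     ({(2 * r + 1, 3 * r + 3)})))))))
    else
     {(x, y). x = r \<and> y = r + k \<or> 2 * r + 1 \<le> x \<and> 0 \<le> y \<and> x + y = 2 * r + 1 + k \<or>
       3 * r + 2 \<le> x \<and> r \<le> y \<and> x + y = 4 * r + 2 + k} \<union>
     ({(x, y). 2 * r + 2 \<le> x \<and> 2 * r + 1 \<le> y \<and> x + y = 4 * r + 3 + k \<or>
       3 * r + 2 \<le> x \<and> 3 * r + 2 \<le> y \<and> x + y = 6 * r + 4 + k} \<union>
     ({(2 * r + 1, 3 * r + 1)} \<union>
     ({(x, y). x + y = 5 * r + 1 \<and> r \<le> x \<and> x \<le> 2 * r - 1 \<or>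
       x + y = 3 * r \<and> 0 \<le> x \<and> x \<le> r - 1} \<union>
     ({(x, y). x - y = - r - 1 \<and> r + 1 \<le> x \<and> x \<le> 2 * r \<or>
       x - y = - 3 * r - 2 \<and> 0 \<le> x \<and> x \<le> r - 1} \<union>
     ({(r, 2 * r + 1)} \<union>
     ({(x, y). x - y = - r \<and> 0 \<le> x \<and> x \<le> r - 1 \<or>
       x - y = r + 1 \<and> r + 1 \<le> x \<and> x \<le> 2 * r - 1} \<union>
     ({(2 * r, r - 1)}))))))))"

definition B_cells :: "int \<Rightarrow> int \<Rightarrow> (int \<times> int) set" where
  "B_cells r k =
    (if k = 0 then {(3 * r + 1, r), (2 * r + 1, 2 * r + 1), (3 * r + 1, 3 * r + 2), (4 * r + 1, 2 * r + 1),
    (3 * r, 3 * r + 1), (4 * r + 1, 4 * r + 1)}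
    else if k = 1 then {(3 * r + 1, r + 1), (4 * r + 1, 0), (3 * r, r), (4 * r + 1, 2 * r),
    (3 * r + 1, r - 1), (2 * r + 1, 2 * r)}
    else
     {(x, y). x - y = 2 * r + 1 - k \<and> 3 * r + 2 - k \<le> x \<and> x \<le> 3 * r + 1 \<or>
       x - y = 4 * r + 2 - k \<and> 4 * r + 2 - k \<le> x \<and> x \<le> 4 * r + 1} \<union>
     ({(x, y). x + y = 4 * r + 1 - k \<and> 3 * r + 1 - k \<le> x \<and> x \<le> 3 * r \<or>
       x + y = 6 * r + 2 - k \<and> 4 * r + 2 - k \<le> x \<and> x \<le> 4 * r + 1} \<union>
     ({(x, y). x - y = 2 * r + 1 + k \<and> 3 * r + 1 \<le> x \<and> x \<le> 3 * r + k \<or>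
       x - y = k \<and> 2 * r + 1 \<le> x \<and> x \<le> 2 * r + k - 1} \<union>
     ({(2 * r + k, 2 * r)} \<union>
     ({(x, y). x - y = k - 1 \<and> 3 * r + 2 \<le> x \<and> x \<le> 3 * r + k \<or>
       x - y = k - 2 * r - 2 \<and> 2 * r + 2 \<le> x \<and> x \<le> 2 * r + k - 1} \<union>
     ({(2 * r + 1, 4 * r + 3 - k)}))))))"

text \<open>The common beginning of \<open>A_step\<close>, \<open>A_second_last\<close> and
  \<open>A_last\<close>: the zigzag runs until its first diagonal meets the row
  \<open>y = 0\<close>, hence \<open>m = k\<close>.\<close>

lemma A_line:
  assumes "0 \<le> k" "k \<le> r - 1"
  shows "walk r (r, r + k) (2 * r + 2 + k, 2 * r + 1) (2 * k + 3)
    {(x, y). x = r \<and> y = r + k \<or> 2 * r + 1 \<le> x \<and> 0 \<le> y \<and> x + y = 2 * r + 1 + k \<or>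
       3 * r + 2 \<le> x \<and> r \<le> y \<and> x + y = 4 * r + 2 + k}"
proof -
  have 1: "walk r (r, r + k) (2 * r + 1, k) 1 {(r, r + k)}"
    using assms by (intro walk_step) (simp add: adj_def board_def move_def)
  have 2: "walk r (2 * r + 1, k) (3 * r + 2 + k, r) (2 * k + 1)
    {(x, y). 2 * r + 1 \<le> x \<and> 0 \<le> y \<and> x + y = 2 * r + 1 + k \<or>
       3 * r + 2 \<le> x \<and> r < y \<and> x + y = 4 * r + 2 + k}"
    by (rule zigzag_odd[where m = k and s = 1 and t = "-1" and a = "r + 1" and b = r])
       (use assms in \<open>auto simp: board_def move_def\<close>)
  have 3: "walk r (3 * r + 2 + k, r) (2 * r + 2 + k, 2 * r + 1) 1 {(3 * r + 2 + k, r)}"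
    using assms by (intro walk_step) (simp add: adj_def board_def move_def)
  show ?thesis
    by (rule walk_weaken[OF walk_trans[OF walk_trans[OF 1 2] 3]]) auto
qed


text \<open>The bound \<open>k \<le> r - 3\<close> says that the next index \<open>k + 2\<close> is
  still below \<open>r\<close>.\<close>

lemma A_step:
  assumes "0 \<le> k" "k \<le> r - 3"
  shows "twisted_walk r True (r, r + k) (r, r + (k + 2)) (8 * k + 14) (A_cells r k)"
proof -
  have 1: "walk r (2 * r + 2 + k, 2 * r + 1) (3 * r + 1, 3 * r + 3 + k) (2 * k + 3)
    {(x, y). 2 * r + 1 \<le> x \<and> 2 * r + 1 \<le> y \<and> x + y = 4 * r + 3 + k \<or>
       3 * r + 2 \<le> x \<and> 3 * r + 2 \<le> y \<and> x + y = 6 * r + 4 + k}"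
    by (rule zigzag_odd[where m = "k + 1" and s = "-1" and t = 1 and a = r and b = "r + 1"])
       (use assms in \<open>auto simp: board_def move_def\<close>)
  have 2: "walk r (3 * r + 1, 3 * r + 3 + k) (3 * r - 1 - k, 3 * r + 1) (2 * (k + 2))
    {(x, y). x - y = - 2 - k \<and> 3 * r - k \<le> x \<and> x \<le> 3 * r + 1 \<or>
       x - y = 2 * r - 1 - k \<and> 4 * r - k \<le> x \<and> x \<le> 4 * r + 1}"
    by (rule zigzag_even[where m = "k + 2" and s = "-1" and t = "-1" and a = r and b = "-r - 1"])
       (use assms in \<open>auto simp: board_def move_def\<close>)
  have 3: "walk r (3 * r - 1 - k, 3 * r + 1) (3 * r + 1, 3 * r - 1 - k) (2 * (k + 2))
    {(x, y). x + y = 6 * r - k \<and> 3 * r - 1 - k \<le> x \<and> x \<le> 3 * r \<or>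
       x + y = 8 * r + 1 - k \<and> 4 * r - k \<le> x \<and> x \<le> 4 * r + 1}"
    by (rule zigzag_even[where m = "k + 2" and s = 1 and t = "-1" and a = "r + 1" and b = r])
       (use assms in \<open>auto simp: board_def move_def\<close>)
  have "walk r (r, r + k) (3 * r + 1, 3 * r - 1 - k) (8 * k + 14) (A_cells r k)"
    \<comment> \<open>The nesting of \<open>walk_trans\<close> reproduces the bracketing of the
      unions in \<open>A_cells\<close>, so the inclusion is reflexive after unfolding.\<close>
    by (rule walk_weaken[OF walk_trans[OF A_line walk_trans[OF 1 walk_trans[OF 2 3]]]])
       (use assms in \<open>simp_all add: A_cells_def\<close>)
  \<comment> \<open>The end \<open>(3 * r + 1, 3 * r - 1 - k)\<close> is the half turn of
    \<open>(r, r + (k + 2))\<close>.\<close>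
  then show ?thesis
    by (intro twisted_walkI) (simp add: algebra_simps)
qed


text \<open>For \<open>k = r - 2\<close> the index \<open>k + 2\<close> is out of range, so the walk
  leaves the pattern of \<open>A_step\<close> and crosses over to the spiral through the
  B's.\<close>

lemma A_second_last:
  assumes "2 \<le> r" and k: "k = r - 2"
  shows "twisted_walk r True (r, r + k) (3 * r + 1, r + k) (10 * k + 15) (A_cells r k)"
proof -
  have 1: "walk r (2 * r + 2 + k, 2 * r + 1) (3 * r + 1, 4 * r + 1) (2 * k + 3)
    {(x, y). 2 * r + 1 \<le> x \<and> 2 * r + 1 \<le> y \<and> x + y = 4 * r + 3 + k \<or>
       3 * r + 2 \<le> x \<and> 3 * r + 2 \<le> y \<and> x + y = 6 * r + 4 + k}"
    by (rule zigzag_odd[where m = "k + 1" and s = "-1" and t = "1" and a = "r" and b = "r + 1"])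
       (use assms in \<open>auto simp: board_def move_def\<close>)
  \<comment> \<open>This zigzag is one move shorter than its counterpart in \<open>A_step\<close>;
    it stops before \<open>(2 * r + 1, 3 * r + 1)\<close>, a cell left to
    \<open>A_last\<close>.\<close>
  have 2: "walk r (3 * r + 1, 4 * r + 1) (3 * r + 2, 2 * r + 1) (2 * k + 3)
    {(x, y). x - y = - 2 - k \<and> 3 * r - k \<le> x \<and> x \<le> 3 * r + 1 \<or>
       x - y = 2 * r - 1 - k \<and> 4 * r - k + 1 \<le> x \<and> x \<le> 4 * r + 1}"
    by (rule zigzag_odd[where m = "k + 1" and s = "-1" and t = "-1" and a = "r" and b = "-r - 1"])
       (use assms in \<open>auto simp: board_def move_def\<close>)
  have 3: "walk r (3 * r + 2, 2 * r + 1) (2 * r + 1, r + 1) 1 {(3 * r + 2, 2 * r + 1)}"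
    using assms by (intro walk_step) (simp add: adj_def board_def move_def)
  have 4: "walk r (2 * r + 1, r + 1) (3 * r, 2 * r) (2 * (k + 1))
    {(x, y). x - y = r \<and> 2 * r + 1 \<le> x \<and> x \<le> 3 * r - 1 \<or>
       x - y = 3 * r + 1 \<and> 3 * r + 2 \<le> x \<and> x \<le> 4 * r}"
    by (rule zigzag_even[where m = "k + 1" and s = "1" and t = "1" and a = "r + 1" and b = "-r"])
       (use assms in \<open>auto simp: board_def move_def\<close>)
  have 5: "walk r (3 * r, 2 * r) (4 * r, 3 * r + 1) 1 {(3 * r, 2 * r)}"
    using assms by (intro walk_step) (simp add: adj_def board_def move_def)
  have 6: "walk r (4 * r, 3 * r + 1) (2 * r + 1, 3 * r + 3) (2 * k + 1)
    {(x, y). x - y = r - 1 \<and> 3 * r + 2 \<le> x \<and> x \<le> 4 * r \<or>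
       x - y = - r - 2 \<and> 2 * r + 2 \<le> x \<and> x \<le> 3 * r - 1}"
    by (rule zigzag_odd[where m = "k" and s = "-1" and t = "-1" and a = "-r - 1" and b = "r"])
       (use assms in \<open>auto simp: board_def move_def\<close>)
  have 7: "walk r (2 * r + 1, 3 * r + 3) (r, 3 * r + 1 - k) 1 {(2 * r + 1, 3 * r + 3)}"
    using assms by (intro walk_step) (simp add: adj_def board_def move_def)
  have "walk r (r, r + k) (r, 3 * r + 1 - k) (10 * k + 15) (A_cells r k)"
    by (rule walk_weaken[OF walk_trans[OF A_line walk_trans[OF 1 walk_trans[OF 2 walk_trans[OF 3
          walk_trans[OF 4 walk_trans[OF 5 walk_trans[OF 6 7]]]]]]]])
       (use assms in \<open>simp_all add: A_cells_def\<close>)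
  then show ?thesis
    by (intro twisted_walkI) (simp add: algebra_simps)
qed

text \<open>The only piece that changes no sheet. It makes a detour through the left half of the
  board, along diagonals that are needed modulo the half turn to complete the coverage.\<close>

lemma A_last:
  assumes "2 \<le> r" and k: "k = r - 1"
  shows "twisted_walk r False (r, r + k) (3 * r + 1, r + k) (10 * k + 13) (A_cells r k)"
proof -
  have 1: "walk r (2 * r + 2 + k, 2 * r + 1) (2 * r + 1, 3 * r + 1) (2 * (k + 1))
    {(x, y). 2 * r + 2 \<le> x \<and> 2 * r + 1 \<le> y \<and> x + y = 4 * r + 3 + k \<or>
       3 * r + 2 \<le> x \<and> 3 * r + 2 \<le> y \<and> x + y = 6 * r + 4 + k}"
    by (rule zigzag_even[where m = "k + 1" and s = "-1" and t = "1" and a = "r" and b = "r + 1"])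
       (use assms in \<open>auto simp: board_def move_def\<close>)
  have 2: "walk r (2 * r + 1, 3 * r + 1) (r, 4 * r + 1) 1 {(2 * r + 1, 3 * r + 1)}"
    using assms by (intro walk_step) (simp add: adj_def board_def move_def)
  have 3: "walk r (r, 4 * r + 1) (2 * r, 3 * r + 1) (2 * r)
    {(x, y). x + y = 5 * r + 1 \<and> r \<le> x \<and> x \<le> 2 * r - 1 \<or>
       x + y = 3 * r \<and> 0 \<le> x \<and> x \<le> r - 1}"
    by (rule zigzag_even[where m = "r" and s = "1" and t = "-1" and a = "-r" and b = "-r - 1"])
       (use assms in \<open>auto simp: board_def move_def\<close>)
  have 4: "walk r (2 * r, 3 * r + 1) (r, 2 * r + 1) (2 * r)
    {(x, y). x - y = - r - 1 \<and> r + 1 \<le> x \<and> x \<le> 2 * r \<or>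
       x - y = - 3 * r - 2 \<and> 0 \<le> x \<and> x \<le> r - 1}"
    by (rule zigzag_even[where m = "r" and s = "-1" and t = "-1" and a = "-r - 1" and b = "r"])
       (use assms in \<open>auto simp: board_def move_def\<close>)
  have 5: "walk r (r, 2 * r + 1) (0, r) 1 {(r, 2 * r + 1)}"
    using assms by (intro walk_step) (simp add: adj_def board_def move_def)
  have 6: "walk r (0, r) (2 * r, r - 1) (2 * r - 1)
    {(x, y). x - y = - r \<and> 0 \<le> x \<and> x \<le> r - 1 \<or>
       x - y = r + 1 \<and> r + 1 \<le> x \<and> x \<le> 2 * r - 1}"
    by (rule zigzag_odd[where m = "r - 1" and s = "1" and t = "1" and a = "r + 1" and b = "-r"])
       (use assms in \<open>auto simp: board_def move_def\<close>)
  have 7: "walk r (2 * r, r - 1) (3 * r + 1, r + k) 1 {(2 * r, r - 1)}"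
    using assms by (intro walk_step) (simp add: adj_def board_def move_def)
  have "walk r (r, r + k) (3 * r + 1, r + k) (10 * k + 13) (A_cells r k)"
    by (rule walk_weaken[OF walk_trans[OF A_line walk_trans[OF 1 walk_trans[OF 2 walk_trans[OF 3
          walk_trans[OF 4 walk_trans[OF 5 walk_trans[OF 6 7]]]]]]]])
       (use assms in \<open>simp_all add: A_cells_def\<close>)
  then show ?thesis
    by (rule twisted_walkI)
qed

text \<open>The counterpart of \<open>A_step\<close> with decreasing index: started from
  \<open>k + 2\<close> it takes \<open>8 * k + 14\<close> steps, as many as \<open>A_step\<close>
  from \<open>k\<close>.\<close>

lemma B_step:
  assumes "2 \<le> k" "k \<le> r - 1"
  shows "twisted_walk r True (3 * r + 1, r + k) (3 * r + 1, r + (k - 2)) (8 * k - 2) (B_cells r k)"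
proof -
  have 1: "walk r (3 * r + 1, r + k) (3 * r + 1 - k, r) (2 * k)
    {(x, y). x - y = 2 * r + 1 - k \<and> 3 * r + 2 - k \<le> x \<and> x \<le> 3 * r + 1 \<or>
       x - y = 4 * r + 2 - k \<and> 4 * r + 2 - k \<le> x \<and> x \<le> 4 * r + 1}"
    by (rule zigzag_even[where m = "k" and s = "-1" and t = "-1" and a = "r" and b = "-r - 1"])
       (use assms in \<open>auto simp: board_def move_def\<close>)
  have 2: "walk r (3 * r + 1 - k, r) (3 * r + 1, r - k) (2 * k)
    {(x, y). x + y = 4 * r + 1 - k \<and> 3 * r + 1 - k \<le> x \<and> x \<le> 3 * r \<or>
       x + y = 6 * r + 2 - k \<and> 4 * r + 2 - k \<le> x \<and> x \<le> 4 * r + 1}"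
    by (rule zigzag_even[where m = "k" and s = "1" and t = "-1" and a = "r + 1" and b = "r"])
       (use assms in \<open>auto simp: board_def move_def\<close>)
  have 3: "walk r (3 * r + 1, r - k) (2 * r + k, 2 * r) (2 * k - 1)
    {(x, y). x - y = 2 * r + 1 + k \<and> 3 * r + 1 \<le> x \<and> x \<le> 3 * r + k \<or>
       x - y = k \<and> 2 * r + 1 \<le> x \<and> x \<le> 2 * r + k - 1}"
    by (rule zigzag_odd[where m = "k - 1" and s = "1" and t = "1" and a = "-r" and b = "r + 1"])
       (use assms in \<open>auto simp: board_def move_def\<close>)
  have 4: "walk r (2 * r + k, 2 * r) (3 * r + k, 3 * r + 1) 1 {(2 * r + k, 2 * r)}"
    using assms by (intro walk_step) (simp add: adj_def board_def move_def)
  have 5: "walk r (3 * r + k, 3 * r + 1) (2 * r + 1, 4 * r + 3 - k) (2 * k - 3)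
    {(x, y). x - y = k - 1 \<and> 3 * r + 2 \<le> x \<and> x \<le> 3 * r + k \<or>
       x - y = k - 2 * r - 2 \<and> 2 * r + 2 \<le> x \<and> x \<le> 2 * r + k - 1}"
    by (rule zigzag_odd[where m = "k - 2" and s = "-1" and t = "-1" and a = "-r - 1" and b = "r"])
       (use assms in \<open>auto simp: board_def move_def\<close>)
  have 6: "walk r (2 * r + 1, 4 * r + 3 - k) (r, 3 * r + 3 - k) 1 {(2 * r + 1, 4 * r + 3 - k)}"
    using assms by (intro walk_step) (simp add: adj_def board_def move_def)
  have "walk r (3 * r + 1, r + k) (r, 3 * r + 3 - k) (8 * k - 2) (B_cells r k)"
    by (rule walk_weaken[OF walk_trans[OF 1 walk_trans[OF 2 walk_trans[OF 3
          walk_trans[OF 4 walk_trans[OF 5 6]]]]]])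
       (use assms in \<open>simp_all add: B_cells_def\<close>)
  then show ?thesis
    by (intro twisted_walkI) (simp add: algebra_simps)
qed

text \<open>For the indices 0 and 1 the zigzag of \<open>2 * k - 3\<close> moves in
  \<open>B_step\<close> would have negative length, so \<open>B_zero\<close> and
  \<open>B_one\<close> are explicit lists. They lead to the start of the other spiral.\<close>

lemma B_zero:
  assumes "2 \<le> r"
  shows "twisted_walk r True (3 * r + 1, r) (r, r + 1) 6 (B_cells r 0)"
proof -
  let ?vs = "[(3 * r + 1, r), (2 * r + 1, 2 * r + 1), (3 * r + 1, 3 * r + 2), (4 * r + 1, 2 * r + 1),
    (3 * r, 3 * r + 1), (4 * r + 1, 4 * r + 1)]"
  have "walk r (3 * r + 1, r) (3 * r + 1, 3 * r) 6 (set ?vs)"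
    using walk_list[of r ?vs "(3 * r + 1, 3 * r)"] assms
    by (simp add: adj_def board_def move_def)
  then show ?thesis
    by (intro twisted_walkI) (simp add: B_cells_def)
qed

lemma B_one:
  assumes "2 \<le> r"
  shows "twisted_walk r True (3 * r + 1, r + 1) (r, r) 6 (B_cells r 1)"
proof -
  let ?vs = "[(3 * r + 1, r + 1), (4 * r + 1, 0), (3 * r, r), (4 * r + 1, 2 * r),
    (3 * r + 1, r - 1), (2 * r + 1, 2 * r)]"
  have "walk r (3 * r + 1, r + 1) (3 * r + 1, 3 * r + 1) 6 (set ?vs)"
    using walk_list[of r ?vs "(3 * r + 1, 3 * r + 1)"] assms
    by (simp add: adj_def board_def move_def)
  then show ?thesis
    by (intro twisted_walkI) (simp add: B_cells_def)
qed

section \<open>Covering the board\<close>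

text \<open>It suffices to treat the right half of the board, as the half turn exchanges the two
  halves. First every family of diagonals is united over \<open>k\<close> into a region; then the
  regions are matched with the blocks of the board.\<close>

lemma cells_cover:
  assumes "2 \<le> r" and "(x0, y0) \<in> board r" and "2 * r + 1 \<le> x0"
  defines "C \<equiv> \<Union>k\<in>{0..<r}. A_cells r k \<union> B_cells r k"
  shows "(x0, y0) \<in> C \<or> half_turn r (x0, y0) \<in> C"
proof -
  \<comment> \<open>In \<open>F1\<close> to \<open>F8\<close> the witness is the equation of the
    diagonal in \<open>A_cells\<close>, solved for \<open>k\<close>.\<close>
  have F1: "(x, y) \<in> C" if "2 * r + 1 \<le> x" "0 \<le> y" "x + y \<le> 3 * r" for x y
    using that assms(1) unfolding C_def
    by (intro UN_I[of "x + y - 2 * r - 1"]) (auto simp: A_cells_def)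
  have F2: "(x, y) \<in> C" if "3 * r + 2 \<le> x" "r \<le> y" "x + y \<le> 5 * r + 1" for x y
    using that assms(1) unfolding C_def
    by (intro UN_I[of "x + y - 4 * r - 2"]) (auto simp: A_cells_def)
  have F3: "(x, y) \<in> C" if "2 * r + 1 \<le> x" "2 * r + 1 \<le> y" "4 * r + 3 \<le> x + y" "x + y \<le> 5 * r + 2" for x y
    using that assms(1) unfolding C_def
    by (intro UN_I[of "x + y - 4 * r - 3"]) (auto simp: A_cells_def)
  have F4: "(x, y) \<in> C" if "3 * r + 2 \<le> x" "3 * r + 2 \<le> y" "x + y \<le> 7 * r + 3" for x y
    using that assms(1) unfolding C_def
    by (intro UN_I[of "x + y - 6 * r - 4"]) (auto simp: A_cells_def)
  have F5: "(x, y) \<in> C" if "x \<le> 3 * r + 1" "3 * r + 2 \<le> y" "x + 2 \<le> y" "y \<le> x + r" for x y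
    using that assms(1) unfolding C_def
    by (intro UN_I[of "y - x - 2"]) (auto simp: A_cells_def)
  have F6: "(x, y) \<in> C" if "x \<le> 4 * r + 1" "2 * r + 1 \<le> y" "y + r + 1 \<le> x" "x \<le> y + 2 * r - 1" for x y
    using that assms(1) unfolding C_def
    by (intro UN_I[of "2 * r - 1 - x + y"]) (auto simp: A_cells_def)
  have F7: "(x, y) \<in> C" if "x \<le> 3 * r" "y \<le> 3 * r + 1" "5 * r + 3 \<le> x + y" "x + y \<le> 6 * r" for x y
    using that assms(1) unfolding C_def
    by (intro UN_I[of "6 * r - x - y"]) (auto simp: A_cells_def)
  have F8: "(x, y) \<in> C" if "x \<le> 4 * r + 1" "y \<le> 4 * r + 1" "7 * r + 4 \<le> x + y" "x + y \<le> 8 * r + 1" for x y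
    using that assms(1) unfolding C_def
    by (intro UN_I[of "8 * r + 1 - x - y"]) (auto simp: A_cells_def)
  \<comment> \<open>Cells that occur only in the crossing piece \<open>k = r - 2\<close>.\<close>
  have C1: "(x, y) \<in> C" if "x - y = r" "2 * r + 1 \<le> x" "x \<le> 3 * r" for x y
    using that assms(1) unfolding C_def
    by (intro UN_I[of "r - 2"]) (auto simp: A_cells_def)
  have C2: "(x, y) \<in> C" if "x - y = 3 * r + 1" "3 * r + 2 \<le> x" "x \<le> 4 * r" for x y
    using that assms(1) unfolding C_def
    by (intro UN_I[of "r - 2"]) (auto simp: A_cells_def)
  have C3: "(x, y) \<in> C" if "x - y = r - 1" "3 * r + 2 \<le> x" "x \<le> 4 * r" for x y
    using that assms(1) unfolding C_def
    by (intro UN_I[of "r - 2"]) (auto simp: A_cells_def)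
  have C4: "(x, y) \<in> C" if "x - y = - r - 2" "2 * r + 1 \<le> x" "x \<le> 3 * r - 1" for x y
    using that assms(1) unfolding C_def
    by (intro UN_I[of "r - 2"]) (auto simp: A_cells_def)
  \<comment> \<open>Cells of the detour \<open>k = r - 1\<close>. Like those of \<open>A1\<close>,
    they lie in the left half and are therefore applied to the half turn of
    \<open>(x0, y0)\<close>.\<close>
  have D1: "(x, y) \<in> C" if "x + y = 5 * r + 1" "r \<le> x" "x \<le> 2 * r" for x y
    using that assms(1) unfolding C_def
    by (intro UN_I[of "r - 1"]) (auto simp: A_cells_def)
  have D2: "(x, y) \<in> C" if "x + y = 3 * r" "0 \<le> x" "x < r" for x y
    using that assms(1) unfolding C_def
    by (intro UN_I[of "r - 1"]) (auto simp: A_cells_def)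
  have D3: "(x, y) \<in> C" if "x - y = - r - 1" "r \<le> x" "x \<le> 2 * r" for x y
    using that assms(1) unfolding C_def
    by (intro UN_I[of "r - 1"]) (auto simp: A_cells_def)
  have D4: "(x, y) \<in> C" if "x - y = - 3 * r - 2" "0 \<le> x" "x < r" for x y
    using that assms(1) unfolding C_def
    by (intro UN_I[of "r - 1"]) (auto simp: A_cells_def)
  have D5: "(x, y) \<in> C" if "x - y = - r" "0 \<le> x" "x < r" for x y
    using that assms(1) unfolding C_def
    by (intro UN_I[of "r - 1"]) (auto simp: A_cells_def)
  have D6: "(x, y) \<in> C" if "x - y = r + 1" "r < x" "x \<le> 2 * r" for x y
    using that assms(1) unfolding C_def
    by (intro UN_I[of "r - 1"]) (auto simp: A_cells_def)
  have A1: "(x, y) \<in> C" if "x = r" "r \<le> y" "y \<le> 2 * r - 1" for x y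
    using that assms(1) unfolding C_def
    by (intro UN_I[of "y - r"]) (auto simp: A_cells_def)
  \<comment> \<open>The same for \<open>B_cells\<close>. At \<open>k = 1\<close> each of
    \<open>G1\<close> to \<open>G6\<close> shrinks to one of the six cells of
    \<open>B_one\<close>.\<close>
  have G1: "(x, y) \<in> C" if "x \<le> 3 * r + 1" "r + 1 \<le> y" "y + r + 2 \<le> x" "x \<le> y + 2 * r" for x y
    using that assms(1) unfolding C_def
    by (intro UN_I[of "2 * r + 1 - x + y"]) (auto simp: B_cells_def)
  have G2: "(x, y) \<in> C" if "x \<le> 4 * r + 1" "0 \<le> y" "3 * r + 3 \<le> x - y" for x y
    using that assms(1) unfolding C_def
    by (intro UN_I[of "4 * r + 2 - x + y"]) (auto simp: B_cells_def)
  have G3: "(x, y) \<in> C" if "x \<le> 3 * r" "y \<le> r" "3 * r + 2 \<le> x + y" for x y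
    using that assms(1) unfolding C_def
    by (intro UN_I[of "4 * r + 1 - x - y"]) (auto simp: B_cells_def)
  have G4: "(x, y) \<in> C" if "x \<le> 4 * r + 1" "y \<le> 2 * r" "5 * r + 3 \<le> x + y" for x y
    using that assms(1) unfolding C_def
    by (intro UN_I[of "6 * r + 2 - x - y"]) (auto simp: B_cells_def)
  have G5: "(x, y) \<in> C" if "3 * r + 1 \<le> x" "y \<le> r - 1" "2 * r + 2 \<le> x - y" "x - y \<le> 3 * r" for x y
    using that assms(1) unfolding C_def
    by (intro UN_I[of "x - y - 2 * r - 1"]) (auto simp: B_cells_def)
  have G6: "(x, y) \<in> C" if "2 * r + 1 \<le> x" "y \<le> 2 * r" "x - y \<le> r - 1" for x y
    using that assms(1) unfolding C_def
    by (intro UN_I[of "x - y"]) (auto simp: B_cells_def)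
  have G7: "(x, y) \<in> C" if "3 * r + 2 \<le> x" "y \<le> 3 * r + 1" "1 \<le> x - y" "x - y \<le> r - 2" for x y
    using that assms(1) unfolding C_def
    by (intro UN_I[of "x - y + 1"]) (auto simp: B_cells_def)
  have G8: "(x, y) \<in> C" if "2 * r + 1 \<le> x" "y \<le> 4 * r + 1" "r + 3 \<le> y - x" "y - x \<le> 2 * r" for x y
    using that assms(1) unfolding C_def
    by (intro UN_I[of "x - y + 2 * r + 2"]) (auto simp: B_cells_def)
  \<comment> \<open>The cells of \<open>B_zero\<close>, which lie on none of the diagonals of
    \<open>B_step\<close> and are listed singly.\<close>
  have H0: "(x, y) \<in> C" if "x = 3 * r + 1" "y = r" for x y
    using that assms(1) unfolding C_def by (intro UN_I[of 0]) (auto simp: B_cells_def)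
  have H1: "(x, y) \<in> C" if "x = 2 * r + 1" "y = 2 * r + 1" for x y
    using that assms(1) unfolding C_def by (intro UN_I[of 0]) (auto simp: B_cells_def)
  have H2: "(x, y) \<in> C" if "x = 3 * r + 1" "y = 3 * r + 2" for x y
    using that assms(1) unfolding C_def by (intro UN_I[of 0]) (auto simp: B_cells_def)
  have H3: "(x, y) \<in> C" if "x = 4 * r + 1" "y = 2 * r + 1" for x y
    using that assms(1) unfolding C_def by (intro UN_I[of 0]) (auto simp: B_cells_def)
  have H4: "(x, y) \<in> C" if "x = 3 * r" "y = 3 * r + 1" for x y
    using that assms(1) unfolding C_def by (intro UN_I[of 0]) (auto simp: B_cells_def)
  have H5: "(x, y) \<in> C" if "x = 4 * r + 1" "y = 4 * r + 1" for x y
    using that assms(1) unfolding C_def by (intro UN_I[of 0]) (auto simp: B_cells_def)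
  have bd: "0 \<le> y0" "x0 \<le> 4 * r + 1" "y0 \<le> 4 * r + 1"
    using assms(2) by (auto simp: board_def)
  \<comment> \<open>Columns and rows are cut at \<open>r\<close>, \<open>2r + 1\<close>, \<open>3r + 2\<close>; \<open>bij\<close> treats column block \<open>i\<close>, row block \<open>j\<close>.\<close>
  have b20: ?thesis if "x0 \<le> 3 * r + 1" "y0 < r"
    using that assms(1,3) bd D1[of "4 * r + 1 - x0" "4 * r + 1 - y0"] F1[of x0 y0] G3[of x0 y0] G5[of x0 y0]
    unfolding fst_conv snd_conv by (smt (verit))
  have b21: ?thesis if "x0 \<le> 3 * r + 1" "r \<le> y0 \<and> y0 \<le> 2 * r"
    using that assms(1,3) bd C1[of x0 y0] D3[of "4 * r + 1 - x0" "4 * r + 1 - y0"] G1[of x0 y0] G3[of x0 y0] G6[of x0 y0] H0[of x0 y0]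
    unfolding fst_conv snd_conv by (smt (verit))
  have b22: ?thesis if "x0 \<le> 3 * r + 1" "2 * r + 1 \<le> y0 \<and> y0 \<le> 3 * r + 1"
    using that assms(1,3) bd A1[of "4 * r + 1 - x0" "4 * r + 1 - y0"] F3[of x0 y0] F7[of x0 y0] H1[of x0 y0] H4[of x0 y0]
    unfolding fst_conv snd_conv by (smt (verit))
  have b23: ?thesis if "x0 \<le> 3 * r + 1" "3 * r + 2 \<le> y0"
    using that assms(1,3) bd C4[of x0 y0] D6[of "4 * r + 1 - x0" "4 * r + 1 - y0"] F5[of x0 y0] G8[of x0 y0] H2[of x0 y0]
    unfolding fst_conv snd_conv by (smt (verit))
  have b30: ?thesis if "3 * r + 2 \<le> x0" "y0 < r"
    using that assms(1,3) bd C2[of x0 y0] D4[of "4 * r + 1 - x0" "4 * r + 1 - y0"] G2[of x0 y0] G5[of x0 y0]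
    unfolding fst_conv snd_conv by (smt (verit))
  have b31: ?thesis if "3 * r + 2 \<le> x0" "r \<le> y0 \<and> y0 \<le> 2 * r"
    using that assms(1,3) bd D2[of "4 * r + 1 - x0" "4 * r + 1 - y0"] F2[of x0 y0] G4[of x0 y0]
    unfolding fst_conv snd_conv by (smt (verit))
  have b32: ?thesis if "3 * r + 2 \<le> x0" "2 * r + 1 \<le> y0 \<and> y0 \<le> 3 * r + 1"
    using that assms(1,3) bd C3[of x0 y0] D5[of "4 * r + 1 - x0" "4 * r + 1 - y0"] F6[of x0 y0] G7[of x0 y0] H3[of x0 y0]
    unfolding fst_conv snd_conv by (smt (verit))
  have b33: ?thesis if "3 * r + 2 \<le> x0" "3 * r + 2 \<le> y0"
    using that assms(1,3) bd F4[of x0 y0] F8[of x0 y0] H5[of x0 y0]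
    unfolding fst_conv snd_conv by (smt (verit))
  show ?thesis
    using b20 b21 b22 b23 b30 b31 b32 b33 by linarith
qed

lemma board_subset_cells:
  assumes "2 \<le> r"
  defines "C \<equiv> \<Union>k\<in>{0..<r}. A_cells r k \<union> B_cells r k"
  shows "board r \<subseteq> C \<union> half_turn r ` C"
proof
  fix v assume v: "v \<in> board r"
  have "v \<in> C \<or> half_turn r v \<in> C"
  proof (cases "2 * r + 1 \<le> fst v")
    case True
    then show ?thesis
      using cells_cover[of r "fst v" "snd v"] assms v by simp
  next
    case False
    moreover have "half_turn r v \<in> board r"
      using v by (auto simp: board_def)
    ultimately show ?thesis
      using cells_cover[of r "fst (half_turn r v)" "snd (half_turn r v)"] assms by auto
  qed
  then show "v \<in> C \<union> half_turn r ` C"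
    using image_eqI[of v "half_turn r" "half_turn r v" C] by auto
qed

section \<open>Assembling the spirals into half a tour\<close>

text \<open>A walk joining the two spirals at index \<open>k + 2 * m\<close> is wrapped in
  \<open>m\<close> layers, each an \<open>A_step\<close> before it and a \<open>B_step\<close> after
  it. The layer at \<open>k + 2 * i\<close> takes \<open>2 * (8 * (k + 2 * i) + 14)\<close> steps,
  and summing over \<open>i < m\<close> gives the quadratic term. The induction peels off the
  outermost layer, so \<open>k\<close> is generalized.\<close>

lemma nested_spirals:
  assumes "0 \<le> k" and "k + 2 * int m < r"
    and "twisted_walk r b (r, r + (k + 2 * int m)) (3 * r + 1, r + (k + 2 * int m)) n S"
  shows "twisted_walk r b (r, r + k) (3 * r + 1, r + k) (n + 16 * int m * int m + 16 * k * int m + 12 * int m)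
    (S \<union> (\<Union>i<m. A_cells r (k + 2 * int i) \<union> B_cells r (k + 2 * int i + 2)))"
  using assms
proof (induction m arbitrary: k)
  case 0
  then show ?case by simp
next
  case (Suc m)
  have IH: "twisted_walk r b (r, r + (k + 2)) (3 * r + 1, r + (k + 2))
      (n + 16 * int m * int m + 16 * (k + 2) * int m + 12 * int m)
      (S \<union> (\<Union>i<m. A_cells r (k + 2 + 2 * int i) \<union> B_cells r (k + 2 + 2 * int i + 2)))"
    by (rule Suc.IH) (use Suc.prems in \<open>simp_all add: algebra_simps\<close>)
  have "twisted_walk r True (r, r + k) (r, r + (k + 2)) (8 * k + 14) (A_cells r k)"
    using Suc.prems by (intro A_step) auto
  moreover have "twisted_walk r True (3 * r + 1, r + (k + 2)) (3 * r + 1, r + k) (8 * k + 14) (B_cells r (k + 2))"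
    using B_step[of "k + 2" r] Suc.prems by (simp add: add.commute)
  \<comment> \<open>The two sheet changes of a layer cancel, which keeps the flag
    \<open>b\<close>.\<close>
  ultimately have "twisted_walk r b (r, r + k) (3 * r + 1, r + k)
      (8 * k + 14 + (n + 16 * int m * int m + 16 * (k + 2) * int m + 12 * int m + (8 * k + 14)))
      (A_cells r k \<union> (S \<union> (\<Union>i<m. A_cells r (k + 2 + 2 * int i) \<union> B_cells r (k + 2 + 2 * int i + 2))
         \<union> B_cells r (k + 2)))"
    using twisted_walk_trans[OF _ twisted_walk_trans[OF IH]] by (cases b) fastforce+
  then show ?case
  proof (rule twisted_walk_weaken)
    show "S \<union> (\<Union>i<Suc m. A_cells r (k + 2 * int i) \<union> B_cells r (k + 2 * int i + 2)) \<subseteq>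
      A_cells r k \<union> (S \<union> (\<Union>i<m. A_cells r (k + 2 + 2 * int i) \<union> B_cells r (k + 2 + 2 * int i + 2))
         \<union> B_cells r (k + 2))"
      unfolding lessThan_Suc_eq_insert_0 by (auto simp: algebra_simps)
  qed (simp add: algebra_simps)
qed

text \<open>The nest is closed by a last piece at index \<open>k\<close>, either
  \<open>B_zero\<close> or \<open>B_one\<close>.\<close>

lemma spiral_pair:
  assumes "0 \<le> k" and "k + 2 * int m < r"
    and "twisted_walk r b (r, r + (k + 2 * int m)) (3 * r + 1, r + (k + 2 * int m)) n (A_cells r (k + 2 * int m))"
    and "twisted_walk r True (3 * r + 1, r + k) v 6 (B_cells r k)"
  shows "twisted_walk r (\<not> b) (r, r + k) v (n + 16 * int m * int m + 16 * k * int m + 12 * int m + 6)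
    (\<Union>i\<le>m. A_cells r (k + 2 * int i) \<union> B_cells r (k + 2 * int i))"
proof -
  let ?T = "A_cells r (k + 2 * int m) \<union>
    (\<Union>i<m. A_cells r (k + 2 * int i) \<union> B_cells r (k + 2 * int i + 2)) \<union> B_cells r k"
  have "twisted_walk r (b \<noteq> True) (r, r + k) v
      (n + 16 * int m * int m + 16 * k * int m + 12 * int m + 6) ?T"
    by (rule twisted_walk_trans[OF nested_spirals[OF assms(1-3)] assms(4)])
  \<comment> \<open>The layers pair \<open>A_cells\<close> at an index with \<open>B_cells\<close>
    at the next one. The innermost \<open>A_cells\<close> and the outermost \<open>B_cells\<close>
    fill the two gaps, and both families then range over \<open>i \<le> m\<close>.\<close>
  moreover have "A_cells r (k + 2 * int i) \<union> B_cells r (k + 2 * int i) \<subseteq> ?T" if "i \<le> m" for i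
  proof (rule Un_least)
    show "A_cells r (k + 2 * int i) \<subseteq> ?T"
    proof (cases "i = m")
      case True
      then show ?thesis by (intro le_supI1) simp
    next
      case False
      then have "i < m" using that by simp
      then have "A_cells r (k + 2 * int i) \<subseteq>
          (\<Union>i<m. A_cells r (k + 2 * int i) \<union> B_cells r (k + 2 * int i + 2))"
        by (intro SUP_upper2[of i]) simp_all
      then show ?thesis by (simp only: le_supI1 le_supI2)
    qed
    show "B_cells r (k + 2 * int i) \<subseteq> ?T"
    proof (cases i)
      case (Suc j)
      then have "B_cells r (k + 2 * int i) = B_cells r (k + 2 * int j + 2)" "j < m"
        using that by (simp_all add: algebra_simps)
      moreover have "B_cells r (k + 2 * int j + 2) \<subseteq>
          (\<Union>i<m. A_cells r (k + 2 * int i) \<union> B_cells r (k + 2 * int i + 2))"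
        using \<open>j < m\<close> by (intro SUP_upper2[of j]) simp_all
      ultimately show ?thesis by (simp only: le_supI1 le_supI2)
    qed simp
  qed
  then have "(\<Union>i\<le>m. A_cells r (k + 2 * int i) \<union> B_cells r (k + 2 * int i)) \<subseteq> ?T"
    by (intro UN_least) simp
  ultimately show ?thesis
    using twisted_walk_weaken[OF _ refl] by simp
qed

text \<open>The nest of even indices leads from \<open>(r, r)\<close> to \<open>(r, r + 1)\<close>,
  that of odd indices back to \<open>(r, r)\<close>. The parity of \<open>r\<close> decides which
  nest contains \<open>A_last\<close> and which \<open>A_second_last\<close>. Either way
  \<open>A_second_last\<close>, \<open>B_zero\<close> and \<open>B_one\<close> change the sheet and
  \<open>A_last\<close> does not, so the total flag is \<open>True\<close>.\<close>

lemma half_tour: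
  assumes "2 \<le> r"
  shows "twisted_walk r True (r, r) (r, r) (8 * r * r + 8 * r + 2) (\<Union>k\<in>{0..<r}. A_cells r k \<union> B_cells r k)"
proof -
  \<comment> \<open>The two bounds say that the largest even index below \<open>r\<close> is at most
    \<open>2 * p\<close> and the largest odd one at most \<open>1 + 2 * q\<close>. The summand 0 is
    kept to match \<open>spiral_pair\<close> at \<open>k = 0\<close>.\<close>
  have split: "(\<Union>k\<in>{0..<r}. f k) \<subseteq> (\<Union>i\<le>p. f (0 + 2 * int i)) \<union> (\<Union>i\<le>q. f (1 + 2 * int i))"
    if "r \<le> 2 * int p + 2" "r \<le> 2 * int q + 3" for f :: "int \<Rightarrow> (int \<times> int) set" and p q
  proof (rule UN_least)
    fix k assume k: "k \<in> {0..<r}"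
    define i where "i = nat (k div 2)"
    have "int i = k div 2"
      using k by (simp add: i_def pos_imp_zdiv_nonneg_iff)
    then have "k = 0 + 2 * int i \<or> k = 1 + 2 * int i"
      by presburger
    then show "f k \<subseteq> (\<Union>i\<le>p. f (0 + 2 * int i)) \<union> (\<Union>i\<le>q. f (1 + 2 * int i))"
    proof
      assume k': "k = 0 + 2 * int i"
      then have "i \<le> p"
        using k that(1) by simp
      then show ?thesis
        unfolding k' by (intro le_supI1 SUP_upper2[of i]) simp_all
    next
      assume k': "k = 1 + 2 * int i"
      then have "i \<le> q"
        using k that(2) by simp
      then show ?thesis
        unfolding k' by (intro le_supI2 SUP_upper2[of i]) simp_all
    qed
  qed
  have B0: "twisted_walk r True (3 * r + 1, r + 0) (r, r + 1) 6 (B_cells r 0)"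
    using B_zero[OF assms] by simp
  note B1 = B_one[OF assms]
  note join = twisted_walk_weaken[OF twisted_walk_trans]
  \<comment> \<open>For both parities of \<open>r\<close> the odd nest has \<open>m\<close> layers;
    the even nest has \<open>m\<close> or \<open>Suc m\<close>.\<close>
  define m where "m = nat ((r - 2) div 2)"
  have "int m = (r - 2) div 2"
    using assms by (simp add: m_def pos_imp_zdiv_nonneg_iff)
  then have "r = 2 * int m + 2 \<or> r = 2 * int m + 3"
    by presburger
  then show ?thesis
  proof
    assume m: "r = 2 * int m + 2"
    have 1: "twisted_walk r True (r, r + (0 + 2 * int m)) (3 * r + 1, r + (0 + 2 * int m)) (10 * (r - 2) + 15) (A_cells r (0 + 2 * int m))"
      using A_second_last[OF assms refl] m by simp
    have 2: "twisted_walk r False (r, r + (1 + 2 * int m)) (3 * r + 1, r + (1 + 2 * int m)) (10 * (r - 1) + 13) (A_cells r (1 + 2 * int m))"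
      using A_last[OF assms refl] m by simp
    have "twisted_walk r ((\<not> True) \<noteq> (\<not> False)) (r, r + 0) (r, r) (8 * r * r + 8 * r + 2) (\<Union>k\<in>{0..<r}. A_cells r k \<union> B_cells r k)"
      by (rule join[OF spiral_pair[OF _ _ 1 B0] spiral_pair[OF _ _ 2 B1] _ split])
         (use m in \<open>simp_all add: algebra_simps\<close>)
    then show ?thesis by simp
  next
    assume m: "r = 2 * int m + 3"
    have 1: "twisted_walk r False (r, r + (0 + 2 * int (Suc m))) (3 * r + 1, r + (0 + 2 * int (Suc m))) (10 * (r - 1) + 13) (A_cells r (0 + 2 * int (Suc m)))"
      using A_last[OF assms refl] m by simp
    have 2: "twisted_walk r True (r, r + (1 + 2 * int m)) (3 * r + 1, r + (1 + 2 * int m)) (10 * (r - 2) + 15) (A_cells r (1 + 2 * int m))"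
      using A_second_last[OF assms refl] m by simp
    have "twisted_walk r ((\<not> False) \<noteq> (\<not> True)) (r, r + 0) (r, r) (8 * r * r + 8 * r + 2) (\<Union>k\<in>{0..<r}. A_cells r k \<union> B_cells r k)"
      by (rule join[OF spiral_pair[OF _ _ 1 B0] spiral_pair[OF _ _ 2 B1] _ split])
         (use m in \<open>simp_all add: algebra_simps\<close>)
    then show ?thesis by simp
  qed
qed

section \<open>The board of side 6 and the conclusion\<close>

lemma half_tour_one:
  defines "vs \<equiv> [(0, 0), (1, 2), (0, 4), (2, 5), (4, 4), (5, 2), (4, 0), (3, 2), (2, 0), (4, 1), (5, 3),
    (4, 5), (2, 4), (0, 5), (1, 3), (0, 1), (2, 2), (3, 4)]"
  shows "twisted_walk 1 True (0, 0) (0, 0) 18 (set vs)" and "board 1 \<subseteq> set vs \<union> half_turn 1 ` set vs"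
proof -
  \<comment> \<open>The list has 18 of the 36 cells, one from each pair exchanged by the half turn,
    and it leads to \<open>(5, 5)\<close>, the half turn of \<open>(0, 0)\<close>.\<close>
  have "walk 1 (0, 0) (5, 5) 18 (set vs)"
    using walk_list[of 1 vs "(5, 5)"] by (simp add: vs_def adj_def board_def move_def)
  then show "twisted_walk 1 True (0, 0) (0, 0) 18 (set vs)"
    by (intro twisted_walkI) simp
  have "{0..5} = {0, 1, 2, 3, 4, 5 :: int}" by auto
  then show "board 1 \<subseteq> set vs \<union> half_turn 1 ` set vs"
    by (simp add: vs_def board_def)
qed

theorem theorem4:
  fixes r :: nat
  assumes "0 < r"
  shows "pre_digraph.hamiltonian (with_proj (leaper_graph r (r + 1) (4 * r + 2) (4 * r + 2)))"
proof (cases "r = 1")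
  case True
  have "walk 1 (0, 0) (0, 0) (2 * 18) (board 1)"
    by (rule closed_walk_of_twisted_walk[OF half_tour_one])
  then show ?thesis
    using True by (intro hamiltonian_of_closed_walk[of r "(0, 0)"]) simp
next
  case False
  then have r: "2 \<le> int r"
    using assms by simp
  have "walk (int r) (int r, int r) (int r, int r) (2 * (8 * int r * int r + 8 * int r + 2)) (board (int r))"
    by (rule closed_walk_of_twisted_walk[OF half_tour[OF r] board_subset_cells[OF r]])
  \<comment> \<open>Twice the length of the half tour is exactly the number of cells, as
    \<open>hamiltonian_of_closed_walk\<close> requires.\<close>
  moreover have "2 * (8 * int r * int r + 8 * int r + 2) = (4 * int r + 2)^2"
    by (simp add: power2_eq_square algebra_simps)
  ultimately show ?thesis
    by (intro hamiltonian_of_closed_walk) simp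
qed

end
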